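(* Let $V=\{t(i)\in T,\ i\in I\}$ with $0<|I|<\infty$ be a nonempty finite subset of $T$, let $L(i)$, $i\in I$, be sets with $P_+(t(i))\subset L(i)\subset P$ for all $i\in I$, and let $$\mathcal K=\{D\in\mathcal{COP}^p:\ e_k^\top Dt(i)=0\ \ \forall k\in L(i),\ \forall i\in I\}.$$ Let $Z_{\mathcal K}=\{\tau(j),j\in J_{\mathcal K}\}$ be the set of vertices of $\mathrm{conv}\,T_0(\mathcal K)$ and $M_{\mathcal K}(j)=\{k\in P: e_k^\top D\tau(j)=0\ \forall D\in\mathcal K\}$, $j\in J_{\mathcal K}$. Then $\mathcal K$ coincides with the cone $$\bar{\mathcal K}=\{D\in\mathcal S(p):\ t^\top Dt\ge0\ \forall t\in\Omega(Z_{\mathcal K});\ e_k^\top D\tau(j)=0\ \forall k\in M_{\mathcal K}(j),\ e_k^\top D\tau(j)\ge0\ \forall k\in P\setminus M_{\mathcal K}(j),\ \forall j\in J_{\mathcal K}\},$$ and there exists a matrix $\bar D\in\bar{\mathcal K}$ such that $$t^\top\bar Dt>0\ \ \forall t\in\Omega(Z_{\mathcal K}),\qquad e_k^\top\bar D\tau(j)>0\ \ \forall k\in P\setminus M_{\mathcal K}(j),\ \forall j\in J_{\mathcal K}.$$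
   Context: Let $p>1$ be an integer, $P=\{1,\dots,p\}$, $e_1,\dots,e_p$ the standard basis of $\mathbb R^p$, $\mathcal S(p)$ the space of real symmetric $p\times p$ matrices, $\mathcal{COP}^p=\{D\in\mathcal S(p): t^\top Dt\ge 0\ \forall t\in\mathbb R^p_+\}$ the cone of copositive matrices, and $T=\{t\in\mathbb R^p_+: \sum_{k\in P}t_k=1\}$. For $t\in\mathbb R^p_+$, $P_+(t)=\{k\in P:t_k>0\}$. For $Q\subset\mathcal{COP}^p$, the set of zeros of $Q$ is $T_0(Q)=\{t\in T: t^\top Dt=0\ \forall D\in Q\}$; for closed convex $Q$ with $T_0(Q)\neq\emptyset$, $\mathrm{conv}\,T_0(Q)$ is a polytope, so its set of vertices (extreme points) is finite. For a nonempty finite set $W=\{w(i),i\in I'\}\subset T$ put $\sigma(W)=\min\{w_k(i): k\in P_+(w(i)),\ i\in I'\}$ and $\Omega(W)=\{t\in T:\rho(t,\mathrm{conv}\,W)\ge\sigma(W)\}$, where $\rho(l,\mathcal B)=\min_{\tau\in\mathcal B}\sum_{k\in P}|l_k-\tau_k|$ is the $\ell_1$-distance and $\mathrm{conv}$ denotes convex hull. *)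

theory Defs
  imports "HOL-Analysis.Analysis"
begin

definition copositive_cone :: "(real ^ 'n ^ 'n) set" where
  "copositive_cone =
     {D. transpose D = D \<and> (\<forall>t. (\<forall>k. 0 \<le> t $ k) \<longrightarrow> 0 \<le> t \<bullet> (D *v t))}"

definition std_simplex :: "(real ^ 'n) set" where
  "std_simplex = {t. (\<forall>k. 0 \<le> t $ k) \<and> (\<Sum>k\<in>UNIV. t $ k) = 1}"

definition pos_supp :: "real ^ 'n \<Rightarrow> 'n set" where
  "pos_supp t = {k. t $ k > 0}"

definition zero_set :: "(real ^ 'n ^ 'n) set \<Rightarrow> (real ^ 'n) set" where
  "zero_set Q = {t \<in> std_simplex. \<forall>D\<in>Q. t \<bullet> (D *v t) = 0}"

text \<open>Intended for finite nonempty subsets of the simplex, where the minimum is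
  over a finite nonempty set of positive numbers.\<close>

definition min_pos_entry :: "(real ^ 'n) set \<Rightarrow> real" where
  "min_pos_entry W = Min {w $ k | w k. w \<in> W \<and> k \<in> pos_supp w}"

definition l1_setdist :: "real ^ 'n \<Rightarrow> (real ^ 'n) set \<Rightarrow> real" where
  "l1_setdist l B = (INF \<tau>\<in>B. \<Sum>k\<in>UNIV. \<bar>l $ k - \<tau> $ k\<bar>)"

text \<open>The infimum is a minimum on nonempty compact sets, in particular on
  the convex hull of a nonempty finite set.\<close>

lemma l1_setdist_attained:
  fixes B :: "(real ^ 'n) set"
  assumes "compact B" "B \<noteq> {}"
  shows "\<exists>\<tau>\<in>B. l1_setdist l B = (\<Sum>k\<in>UNIV. \<bar>l $ k - \<tau> $ k\<bar>)
           \<and> (\<forall>\<upsilon>\<in>B. l1_setdist l B \<le> (\<Sum>k\<in>UNIV. \<bar>l $ k - \<upsilon> $ k\<bar>))"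
proof -
  let ?f = "\<lambda>\<tau>. \<Sum>k\<in>UNIV. \<bar>l $ k - \<tau> $ k\<bar>"
  have "continuous_on B ?f"
    by (intro continuous_intros)
  then obtain \<tau> where \<tau>: "\<tau> \<in> B" "\<forall>\<upsilon>\<in>B. ?f \<tau> \<le> ?f \<upsilon>"
    using continuous_attains_inf[OF assms] by blast
  have "l1_setdist l B = ?f \<tau>"
    unfolding l1_setdist_def
    by (rule cInf_eq_minimum) (use \<tau> in auto)
  with \<tau> show ?thesis by auto
qed

definition outer_region :: "(real ^ 'n) set \<Rightarrow> (real ^ 'n) set" where
  "outer_region W = {t \<in> std_simplex. l1_setdist t (convex hull W) \<ge> min_pos_entry W}"

definition polytope_vertices :: "(real ^ 'n) set \<Rightarrow> (real ^ 'n) set" where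
  "polytope_vertices S = {x. x extreme_point_of S}"

text \<open>Vertices are used as their own indices: \<open>null_rows K \<tau>\<close> plays the role of
  $M_K(j)$ for $\tau = \tau(j)$; \<open>axis k 1\<close> is the standard basis vector $e_k$.\<close>

definition null_rows :: "(real ^ 'n ^ 'n) set \<Rightarrow> real ^ 'n \<Rightarrow> 'n set" where
  "null_rows K \<tau> = {k. \<forall>D\<in>K. axis k 1 \<bullet> (D *v \<tau>) = 0}"

end

theory Submission
  imports Defs
begin

text \<open>If the support of \<open>s \<ge> 0\<close> contains the support of a zero \<open>\<tau>\<close> of \<open>D\<close>
  with \<open>D\<tau> \<ge> 0\<close>, then subtracting the largest possible multiple of \<open>\<tau>\<close> from \<open>s\<close>
  shrinks the support and does not increase the quadratic form. Points of the simplex closer than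
  \<open>\<sigma>(W)\<close> to \<open>conv W\<close> always admit such a \<open>\<tau> \<in> W\<close>, so by induction on the support
  the conditions defining \<open>Kbar\<close> force copositivity. The same subtraction shows that a vertex
  of \<open>conv T\<^sub>0(K)\<close> is determined by its support, so there are finitely many vertices.
  Every condition to be made strict is the positivity of a linear functional that is nonnegative
  on \<open>K\<close> and nonzero somewhere on \<open>K\<close>, hence positive on the relative interior
  of \<open>K\<close>.\<close>

section \<open>Symmetric quadratic forms and zeros of copositive matrices\<close>

lemma symmetric_form_commute:
  fixes D :: "real ^ 'n ^ 'n"
  assumes "transpose D = D"
  shows "x \<bullet> (D *v y) = y \<bullet> (D *v x)"
  by (metis assms dot_lmul_matrix inner_commute transpose_matrix_vector)

lemma symmetric_form_add_scaleR:
  fixes D :: "real ^ 'n ^ 'n"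
  assumes "transpose D = D"
  shows "(x + c *\<^sub>R y) \<bullet> (D *v (x + c *\<^sub>R y))
           = x \<bullet> (D *v x) + 2 * c * (y \<bullet> (D *v x)) + c\<^sup>2 * (y \<bullet> (D *v y))"
  using symmetric_form_commute[OF assms, of x y]
  by (simp add: matrix_vector_right_distrib matrix_vector_mult_scaleR inner_add_left
      inner_add_right power2_eq_square algebra_simps)

lemma form_scaleR:
  fixes D :: "real ^ 'n ^ 'n"
  shows "(c *\<^sub>R x) \<bullet> (D *v (c *\<^sub>R x)) = c\<^sup>2 * (x \<bullet> (D *v x))"
  by (simp add: matrix_vector_mult_scaleR power2_eq_square)

text \<open>This is the first-order condition at a one-sided minimum: for small \<open>e\<close> the
  linear term dominates the quadratic one.\<close>

lemma linear_coeff_nonneg: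
  fixes a b :: real
  assumes "\<And>e. e > 0 \<Longrightarrow> 0 \<le> 2 * e * a + e\<^sup>2 * b"
  shows "0 \<le> a"
proof (rule ccontr)
  assume "\<not> 0 \<le> a"
  \<comment> \<open>With this \<open>e\<close>, \<open>e * b\<close> is at most \<open>- a\<close>,
    so \<open>2 * a + e * b\<close> is at most \<open>a\<close>, which is negative.\<close>
  define e where "e = - a / (\<bar>b\<bar> + 1)"
  have "e > 0"
    using \<open>\<not> 0 \<le> a\<close> by (simp add: e_def divide_neg_pos)
  moreover have "e * (\<bar>b\<bar> + 1) = - a"
    by (simp add: e_def)
  ultimately have "e * b \<le> - a"
    by (smt (verit) mult_left_mono)
  have "0 \<le> e * (2 * a + e * b)"
    using assms[OF \<open>e > 0\<close>] by (simp add: power2_eq_square algebra_simps)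
  then have "0 \<le> 2 * a + e * b"
    using \<open>e > 0\<close> by (simp add: zero_le_mult_iff)
  with \<open>e * b \<le> - a\<close> \<open>\<not> 0 \<le> a\<close> show False
    by simp
qed

text \<open>A zero minimises the form over the nonnegative orthant, and
  \<open>2 * (D *v x) $ k\<close> is the directional derivative at \<open>x\<close> along the
  \<open>k\<close>-th basis vector, a direction that stays in the orthant.\<close>

lemma copositive_zero_nonneg:
  fixes D :: "real ^ 'n ^ 'n"
  assumes D: "D \<in> copositive_cone" and x: "\<And>k. 0 \<le> x $ k" and zero: "x \<bullet> (D *v x) = 0"
  shows "0 \<le> (D *v x) $ k"
proof (rule linear_coeff_nonneg)
  fix e :: real
  assume "e > 0"
  have sym: "transpose D = D" and pos: "\<And>t. \<forall>k. 0 \<le> t $ k \<Longrightarrow> 0 \<le> t \<bullet> (D *v t)"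
    using D by (auto simp: copositive_cone_def)
  have "\<forall>j. 0 \<le> (x + e *\<^sub>R axis k 1) $ j"
    using x \<open>e > 0\<close> by (auto simp: axis_def)
  from pos[OF this] show "0 \<le> 2 * e * (D *v x) $ k + e\<^sup>2 * (axis k 1 \<bullet> (D *v axis k 1))"
    by (simp add: symmetric_form_add_scaleR[OF sym] zero inner_axis')
qed

text \<open>Complementary slackness: the products \<open>x $ j * (D *v x) $ j\<close> are
  nonnegative and sum to zero, so each of them vanishes.\<close>

lemma copositive_zero_on_supp:
  fixes D :: "real ^ 'n ^ 'n"
  assumes D: "D \<in> copositive_cone" and x: "\<And>k. 0 \<le> x $ k" and zero: "x \<bullet> (D *v x) = 0"
    and k: "k \<in> pos_supp x"
  shows "(D *v x) $ k = 0"
proof -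
  have "\<forall>j\<in>UNIV. x $ j * (D *v x) $ j = 0"
    by (subst sum_nonneg_eq_0_iff[symmetric])
      (use zero x copositive_zero_nonneg[OF D x zero] in \<open>auto simp: inner_vec_def\<close>)
  then show ?thesis
    using k by (metis UNIV_I less_irrefl mem_Collect_eq mult_eq_0_iff pos_supp_def)
qed

text \<open>Minimum ratio test: \<open>c\<close> is the least quotient \<open>x $ k / y $ k\<close>
  over the support of \<open>y\<close>, and an index attaining it drops out of the support.\<close>

lemma vec_subtract_max_multiple:
  fixes x y :: "real ^ 'n"
  assumes y: "\<And>k. 0 \<le> y $ k" "pos_supp y \<noteq> {}" and sub: "pos_supp y \<subseteq> pos_supp x"
    and x: "\<And>k. 0 \<le> x $ k"
  obtains c k where "c > 0" "\<And>j. 0 \<le> (x - c *\<^sub>R y) $ j" "k \<in> pos_supp y"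
    "(x - c *\<^sub>R y) $ k = 0"
proof -
  obtain k where k: "k \<in> pos_supp y" "\<And>j. j \<in> pos_supp y \<Longrightarrow> x $ k / y $ k \<le> x $ j / y $ j"
    using arg_min_if_finite(1)[of "pos_supp y" "\<lambda>k. x $ k / y $ k"]
      arg_min_least[of "pos_supp y" _ "\<lambda>k. x $ k / y $ k"] y(2) by auto
  let ?c = "x $ k / y $ k"
  have pos: "0 < y $ k" "0 < x $ k"
    using k(1) sub by (auto simp: pos_supp_def)
  show thesis
  proof (rule that[of ?c k])
    show "?c > 0"
      using pos by simp
    show "(x - ?c *\<^sub>R y) $ k = 0"
      using pos by simp
    show "0 \<le> (x - ?c *\<^sub>R y) $ j" for j
    proof (cases "j \<in> pos_supp y")
      case True
      then have "y $ j > 0"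
        by (simp add: pos_supp_def)
      with k(2)[OF True] show ?thesis
        by (simp add: pos_le_divide_eq)
    next
      case False
      then have "y $ j = 0"
        using y(1)[of j] by (simp add: pos_supp_def)
      with x[of j] show ?thesis
        by simp
    qed
  qed (use k in simp)
qed

section \<open>The simplex and the distance to a convex hull\<close>

lemma std_simplexD:
  assumes "x \<in> std_simplex"
  shows "0 \<le> x $ k" "(\<Sum>k\<in>UNIV. x $ k) = 1" "x \<noteq> 0" "pos_supp x \<noteq> {}"
proof -
  show *: "0 \<le> x $ k" "(\<Sum>k\<in>UNIV. x $ k) = 1" for k
    using assms by (auto simp: std_simplex_def)
  show "x \<noteq> 0"
    using *(2) by auto
  show "pos_supp x \<noteq> {}"
  proof
    assume "pos_supp x = {}"
    then have "x $ k = 0" for k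
      using *(1)[of k] by (metis empty_iff mem_Collect_eq order_le_less pos_supp_def)
    with *(2) show False
      by simp
  qed
qed

lemma normalize_std_simplex:
  fixes x :: "real ^ 'n"
  assumes "\<And>k. 0 \<le> x $ k" "x \<noteq> 0"
  defines "c \<equiv> \<Sum>k\<in>UNIV. x $ k"
  shows "c > 0" "(1 / c) *\<^sub>R x \<in> std_simplex"
proof -
  have "c \<noteq> 0"
    using assms(1,2) by (auto simp: c_def sum_nonneg_eq_0_iff vec_eq_iff)
  moreover have "c \<ge> 0"
    using assms(1) by (simp add: c_def sum_nonneg)
  ultimately show "c > 0"
    by simp
  then show "(1 / c) *\<^sub>R x \<in> std_simplex"
    using assms(1) by (auto simp: std_simplex_def c_def simp flip: sum_divide_distrib)
qed

lemma min_pos_entry: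
  fixes W :: "(real ^ 'n) set"
  assumes "finite W" "W \<noteq> {}" "W \<subseteq> std_simplex"
  shows "min_pos_entry W > 0"
    and "\<And>w k. w \<in> W \<Longrightarrow> k \<in> pos_supp w \<Longrightarrow> min_pos_entry W \<le> w $ k"
proof -
  let ?E = "{w $ k | w k. w \<in> W \<and> k \<in> pos_supp w}"
  have "?E = (\<Union>w\<in>W. ($) w ` pos_supp w)"
    by auto
  then have fin: "finite ?E"
    using assms(1) by simp
  have "?E \<noteq> {}"
    using assms(2,3) std_simplexD(4) by blast
  from Min_in[OF fin this] show "min_pos_entry W > 0"
    by (auto simp: min_pos_entry_def pos_supp_def)
  show "min_pos_entry W \<le> w $ k" if "w \<in> W" "k \<in> pos_supp w" for w k
    unfolding min_pos_entry_def by (rule Min_le[OF fin]) (use that in blast)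
qed

lemma convex_hull_finite_expand:
  fixes W :: "'a::real_vector set"
  assumes "finite W" "x \<in> convex hull W"
  obtains u where "\<And>w. w \<in> W \<Longrightarrow> (0::real) \<le> u w" "sum u W = 1" "x = (\<Sum>w\<in>W. u w *\<^sub>R w)"
  using assms by (auto simp: convex_hull_finite)

text \<open>Otherwise every \<open>w\<close> in \<open>W\<close> has a positive entry off the
  support of \<open>s\<close>, hence carries mass at least \<sigma> there. Averaging, so does the
  point of the hull nearest to \<open>s\<close>. As \<open>s\<close> vanishes there, its distance to
  the hull is at least \<sigma>.\<close>

lemma supp_subset_near_hull:
  fixes W :: "(real ^ 'n) set"
  assumes W: "finite W" "W \<noteq> {}" "W \<subseteq> std_simplex"
    and s: "s \<in> std_simplex" "s \<notin> outer_region W"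
  shows "\<exists>w\<in>W. pos_supp w \<subseteq> pos_supp s"
proof (rule ccontr)
  assume none: "\<not> ?thesis"
  let ?\<sigma> = "min_pos_entry W" and ?N = "- pos_supp s"
  have "compact (convex hull W)" "convex hull W \<noteq> {}"
    using W by (auto intro: finite_imp_compact_convex_hull)
  from l1_setdist_attained[OF this, of s] obtain x where
    x: "x \<in> convex hull W" "l1_setdist s (convex hull W) = (\<Sum>k\<in>UNIV. \<bar>s $ k - x $ k\<bar>)"
    by blast
  obtain u where u: "\<And>w. w \<in> W \<Longrightarrow> 0 \<le> u w" "sum u W = 1" "x = (\<Sum>w\<in>W. u w *\<^sub>R w)"
    using convex_hull_finite_expand[OF W(1) x(1)] by blast
  have out: "?\<sigma> \<le> (\<Sum>k\<in>?N. w $ k)" if w: "w \<in> W" for w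
  proof -
    obtain k where k: "k \<in> pos_supp w" "k \<in> ?N"
      using none w by blast
    have "?\<sigma> \<le> w $ k"
      using min_pos_entry(2)[OF W w k(1)] .
    also have "\<dots> \<le> (\<Sum>k\<in>?N. w $ k)"
      by (rule member_le_sum) (use k W(3) w std_simplexD(1) in auto)
    finally show ?thesis .
  qed
  have "?\<sigma> = (\<Sum>w\<in>W. u w * ?\<sigma>)"
    using u(2) by (simp flip: sum_distrib_right)
  also have "\<dots> \<le> (\<Sum>w\<in>W. u w * (\<Sum>k\<in>?N. w $ k))"
    by (intro sum_mono mult_left_mono out u(1))
  also have "\<dots> = (\<Sum>k\<in>?N. x $ k)"
    unfolding u(3) by (simp add: sum_distrib_left) (rule sum.swap)
  also have "\<dots> \<le> (\<Sum>k\<in>?N. \<bar>s $ k - x $ k\<bar>)"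
  proof (rule sum_mono)
    fix k
    assume "k \<in> ?N"
    then have "s $ k = 0"
      using std_simplexD(1)[OF s(1), of k] by (simp add: pos_supp_def)
    then show "x $ k \<le> \<bar>s $ k - x $ k\<bar>"
      by simp
  qed
  also have "\<dots> \<le> (\<Sum>k\<in>UNIV. \<bar>s $ k - x $ k\<bar>)"
    by (rule sum_mono2) auto
  finally show False
    using s x(2) by (simp add: outer_region_def)
qed

lemma convex_hull_disjoint_outer_region:
  fixes W :: "(real ^ 'n) set"
  assumes W: "finite W" "W \<noteq> {}" "W \<subseteq> std_simplex" and s: "s \<in> convex hull W"
  shows "s \<notin> outer_region W"
proof -
  have "compact (convex hull W)" "convex hull W \<noteq> {}"
    using W by (auto intro: finite_imp_compact_convex_hull)
  from l1_setdist_attained[OF this, of s] s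
  have "l1_setdist s (convex hull W) \<le> (\<Sum>k\<in>UNIV. \<bar>s $ k - s $ k\<bar>)"
    by blast
  with min_pos_entry(1)[OF W] show ?thesis
    by (simp add: outer_region_def)
qed

section \<open>Support reduction: copositivity and finiteness of the vertex set\<close>

lemma copositive_if_nonneg_on_outer_region:
  fixes D :: "real ^ 'n ^ 'n"
  assumes W: "finite W" "W \<noteq> {}" "W \<subseteq> std_simplex" and sym: "transpose D = D"
    and zero: "\<And>w. w \<in> W \<Longrightarrow> w \<bullet> (D *v w) = 0"
    and nonneg: "\<And>w k. w \<in> W \<Longrightarrow> 0 \<le> (D *v w) $ k"
    and outer: "\<And>s. s \<in> outer_region W \<Longrightarrow> 0 \<le> s \<bullet> (D *v s)"
  shows "D \<in> copositive_cone"
proof -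
  have "0 \<le> s \<bullet> (D *v s)" if "\<And>k. 0 \<le> s $ k" for s
    using that
  proof (induction "card (pos_supp s)" arbitrary: s rule: less_induct)
    case less
    show ?case
    proof (cases "\<exists>w\<in>W. pos_supp w \<subseteq> pos_supp s")
      case True
      then obtain w where w: "w \<in> W" "pos_supp w \<subseteq> pos_supp s"
        by blast
      then have "w \<in> std_simplex"
        using W by blast
      note w0 = std_simplexD[OF this]
      obtain c k where ck: "c > 0" "\<And>j. 0 \<le> (s - c *\<^sub>R w) $ j" "k \<in> pos_supp w"
        "(s - c *\<^sub>R w) $ k = 0"
        using vec_subtract_max_multiple[OF w0(1,4) w(2) less.prems] by blast
      \<comment> \<open>The form at \<open>s\<close> is the form at \<open>?r\<close> plus
        \<open>2 * c\<close> times the cross term, since the form vanishes at \<open>w\<close>. The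
        support of \<open>?r\<close> is smaller, so the induction hypothesis applies to it. The
        cross term is nonnegative because \<open>?r\<close> and \<open>D *v w\<close> are.\<close>
      let ?r = "s - c *\<^sub>R w"
      have "pos_supp ?r \<subseteq> pos_supp s"
      proof
        fix j
        assume "j \<in> pos_supp ?r"
        then have "c * w $ j < s $ j"
          by (simp add: pos_supp_def)
        moreover have "0 \<le> c * w $ j"
          using ck(1) w0(1) by simp
        ultimately show "j \<in> pos_supp s"
          by (simp add: pos_supp_def)
      qed
      moreover have "k \<in> pos_supp s" "k \<notin> pos_supp ?r"
        using ck(3,4) w(2) by (auto simp: pos_supp_def)
      ultimately have "card (pos_supp ?r) < card (pos_supp s)"
        by (intro psubset_card_mono) auto
      then have r: "0 \<le> ?r \<bullet> (D *v ?r)"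
        using less.hyps ck(2) by blast
      have "0 \<le> ?r \<bullet> (D *v w)"
        unfolding inner_vec_def using ck(2) nonneg[OF w(1)] by (auto intro!: sum_nonneg)
      then have "0 \<le> w \<bullet> (D *v ?r)"
        by (simp only: symmetric_form_commute[OF sym, of w])
      then show ?thesis
        using symmetric_form_add_scaleR[OF sym, of ?r c w] r zero[OF w(1)] ck(1) by simp
    next
      case False
      show ?thesis
      proof (cases "s = 0")
        case True
        then show ?thesis
          by simp
      next
        case nz: False
        define c where "c = (\<Sum>k\<in>UNIV. s $ k)"
        have c: "c > 0" "(1 / c) *\<^sub>R s \<in> std_simplex"
          using normalize_std_simplex[OF less.prems nz] by (auto simp: c_def)
        \<comment> \<open>Scaling keeps the support, so the normalised vector contains no support
          from \<open>W\<close> either and must lie in the outer region.\<close>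
        have "pos_supp ((1 / c) *\<^sub>R s) = pos_supp s"
          using c(1) by (auto simp: pos_supp_def zero_less_divide_iff)
        with False have "(1 / c) *\<^sub>R s \<in> outer_region W"
          using supp_subset_near_hull[OF W c(2)] by auto
        from outer[OF this] show ?thesis
          using c(1) unfolding form_scaleR by (simp add: zero_le_mult_iff)
      qed
    qed
  qed
  with sym show ?thesis
    by (simp add: copositive_cone_def)
qed

text \<open>If \<open>x\<close> and \<open>y\<close> differed, subtracting a multiple of
  \<open>y\<close> from \<open>x\<close> and normalising would give another common zero, with
  \<open>x\<close> strictly between it and \<open>y\<close>, against extremality.\<close>

lemma zero_set_vertex_unique:
  fixes K :: "(real ^ 'n ^ 'n) set"
  assumes K: "K \<subseteq> copositive_cone" and x: "x \<in> zero_set K" and y: "y \<in> zero_set K"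
    and sub: "pos_supp y \<subseteq> pos_supp x" and ext: "x extreme_point_of convex hull zero_set K"
  shows "x = y"
proof (rule ccontr)
  assume "x \<noteq> y"
  have T: "x \<in> std_simplex" "y \<in> std_simplex"
    using x y by (auto simp: zero_set_def)
  note x0 = std_simplexD[OF T(1)] and y0 = std_simplexD[OF T(2)]
  obtain c k where ck: "c > 0" "\<And>j. 0 \<le> (x - c *\<^sub>R y) $ j"
    using vec_subtract_max_multiple[OF y0(1,4) sub x0(1)] by blast
  let ?r = "x - c *\<^sub>R y"
  \<comment> \<open>This sum excludes \<open>?r = 0\<close>, which would force \<open>c = 1\<close>
    and \<open>x = y\<close>. It is also the normalising factor, so its positivity yields
    \<open>c < 1\<close>.\<close>
  have sum_r: "(\<Sum>k\<in>UNIV. ?r $ k) = 1 - c"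
    by (simp add: sum_subtractf x0(2) y0(2) flip: sum_distrib_left)
  have "?r \<noteq> 0"
    using sum_r \<open>x \<noteq> y\<close> by auto
  from normalize_std_simplex[OF ck(2) this]
  have c: "c < 1" and z: "(1 / (1 - c)) *\<^sub>R ?r \<in> std_simplex" (is "?z \<in> _")
    unfolding sum_r by simp_all
  have "?r \<bullet> (D *v ?r) = 0" if D: "D \<in> K" for D
  proof -
    have cop: "D \<in> copositive_cone" and sym: "transpose D = D"
      using K D by (auto simp: copositive_cone_def)
    have zero: "x \<bullet> (D *v x) = 0" "y \<bullet> (D *v y) = 0"
      using x y D by (auto simp: zero_set_def)
    \<comment> \<open>\<open>D *v x\<close> vanishes on the support of \<open>x\<close>, which
      contains that of \<open>y\<close>, so the cross term disappears.\<close>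
    have "y $ j * (D *v x) $ j = 0" for j
      using copositive_zero_on_supp[OF cop x0(1) zero(1), of j] sub y0(1)[of j]
      by (cases "j \<in> pos_supp y") (auto simp: pos_supp_def)
    then have "y \<bullet> (D *v x) = 0"
      by (simp only: inner_vec_def inner_real_def sum.neutral_const)
    then show ?thesis
      using symmetric_form_add_scaleR[OF sym, of x "- c" y] zero by simp
  qed
  then have "?z \<bullet> (D *v ?z) = 0" if "D \<in> K" for D
    using that unfolding form_scaleR by simp
  with z have "?z \<in> zero_set K"
    unfolding zero_set_def by blast
  then have "?z \<in> convex hull zero_set K" "y \<in> convex hull zero_set K"
    using y by (auto intro: hull_inc)
  moreover have zx: "x = (1 - c) *\<^sub>R ?z + c *\<^sub>R y"
    using c by simp
  moreover have "?z \<noteq> y"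
  proof
    assume "?z = y"
    with zx have "x = (1 - c) *\<^sub>R y + c *\<^sub>R y"
      by simp
    then show False
      using \<open>x \<noteq> y\<close> by (simp flip: scaleR_left_distrib)
  qed
  ultimately show False
    using ext ck(1) c unfolding extreme_point_of_def in_segment by blast
qed

lemma finite_polytope_vertices_zero_set:
  fixes K :: "(real ^ 'n ^ 'n) set"
  assumes "K \<subseteq> copositive_cone"
  shows "finite (polytope_vertices (convex hull zero_set K))"
proof (rule inj_on_finite)
  show "inj_on pos_supp (polytope_vertices (convex hull zero_set K))"
  proof (rule inj_onI)
    fix x y
    assume "x \<in> polytope_vertices (convex hull zero_set K)"
      "y \<in> polytope_vertices (convex hull zero_set K)" "pos_supp x = pos_supp y"
    then show "x = y"
      using zero_set_vertex_unique[OF assms, of x y] extreme_point_of_convex_hull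
      by (fastforce simp: polytope_vertices_def)
  qed
qed (rule subset_UNIV, simp)

section \<open>Compactness and relative interiors\<close>

lemma compact_std_simplex: "compact (std_simplex :: (real ^ 'n) set)"
  unfolding compact_eq_bounded_closed
proof
  have "norm x \<le> 1" if "x \<in> std_simplex" for x :: "real ^ 'n"
    using norm_le_l1_cart[of x] std_simplexD[OF that] by simp
  then show "bounded (std_simplex :: (real ^ 'n) set)"
    by (auto simp: bounded_iff)
  show "closed (std_simplex :: (real ^ 'n) set)"
    unfolding std_simplex_def
    by (intro closed_Collect_conj closed_Collect_all closed_Collect_le closed_Collect_eq
        continuous_intros)
qed

lemma compact_zero_set: "compact (zero_set (K :: (real ^ 'n ^ 'n) set))"
proof -
  have "closed (\<Inter>D\<in>K. {t :: real ^ 'n. t \<bullet> (D *v t) = 0})"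
    by (intro closed_INT ballI closed_Collect_eq continuous_intros
        linear_continuous_on[OF matrix_vector_mul_bounded_linear])
  moreover have "zero_set K = std_simplex \<inter> (\<Inter>D\<in>K. {t. t \<bullet> (D *v t) = 0})"
    by (auto simp: zero_set_def)
  ultimately show ?thesis
    by (simp only: compact_Int_closed compact_std_simplex)
qed

text \<open>The segment from \<open>x\<close> to \<open>z\<close> extends a little beyond
  \<open>z\<close> inside \<open>S\<close>. Since \<open>f\<close> is positive at \<open>x\<close>,
  a value \<open>f z \<le> 0\<close> would make \<open>f\<close> negative at the extended
  point.\<close>

lemma rel_interior_pos_functional:
  fixes S :: "'a::euclidean_space set"
  assumes S: "convex S" and z: "z \<in> rel_interior S" and f: "linear f"
    and nonneg: "\<And>x. x \<in> S \<Longrightarrow> (0::real) \<le> f x" and x: "x \<in> S" "f x > 0"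
  shows "f z > 0"
proof -
  obtain e where e: "e > 1" "(1 - e) *\<^sub>R x + e *\<^sub>R z \<in> S"
    using convex_rel_interior_iff[OF S, of z] z x(1) by auto
  have "0 \<le> (1 - e) * f x + e * f z"
    using nonneg[OF e(2)] by (simp add: linear_add[OF f] linear_scale[OF f])
  moreover have "(1 - e) * f x < 0"
    using e(1) x(2) by (simp add: mult_less_0_iff)
  ultimately show ?thesis
    using e(1) by (smt (verit) zero_less_mult_pos)
qed

section \<open>Equality of the two cones and a strictly feasible matrix\<close>

theorem lemma3:
  fixes t :: "'i \<Rightarrow> real ^ 'n" and I :: "'i set" and L :: "'i \<Rightarrow> 'n set"
    and K Kbar :: "(real ^ 'n ^ 'n) set" and Z :: "(real ^ 'n) set"
  assumes "CARD('n) > 1"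
    and "finite I" and "I \<noteq> {}"
    and "\<And>i. i \<in> I \<Longrightarrow> t i \<in> std_simplex"
    and "\<And>i. i \<in> I \<Longrightarrow> pos_supp (t i) \<subseteq> L i"
    and K: "K = {D \<in> copositive_cone. \<forall>i\<in>I. \<forall>k\<in>L i. axis k 1 \<bullet> (D *v t i) = 0}"
    and Z: "Z = polytope_vertices (convex hull zero_set K)"
    and Kbar: "Kbar = {D. transpose D = D \<and>
                 (\<forall>s\<in>outer_region Z. s \<bullet> (D *v s) \<ge> 0) \<and>
                 (\<forall>\<tau>\<in>Z. (\<forall>k\<in>null_rows K \<tau>. axis k 1 \<bullet> (D *v \<tau>) = 0) \<and>
                         (\<forall>k\<in>UNIV - null_rows K \<tau>. axis k 1 \<bullet> (D *v \<tau>) \<ge> 0))}"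
  shows "K = Kbar \<and>
    (\<exists>Dbar\<in>Kbar.
       (\<forall>s\<in>outer_region Z. s \<bullet> (Dbar *v s) > 0) \<and>
       (\<forall>\<tau>\<in>Z. \<forall>k\<in>UNIV - null_rows K \<tau>. axis k 1 \<bullet> (Dbar *v \<tau>) > 0))"
proof -
  have row: "axis k 1 \<bullet> v = v $ k" for k and v :: "real ^ 'n"
    by (simp add: inner_axis')
  have cop: "K \<subseteq> copositive_cone"
    using K by blast
  have t: "t i \<in> zero_set K" if i: "i \<in> I" for i
  proof -
    have "t i $ k * (D *v t i) $ k = 0" if "D \<in> K" for D k
      using that i assms(5)[OF i] std_simplexD(1)[OF assms(4)[OF i], of k] K
      by (cases "k \<in> pos_supp (t i)") (auto simp: row pos_supp_def)
    then have "t i \<bullet> (D *v t i) = 0" if "D \<in> K" for D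
      using that by (simp only: inner_vec_def inner_real_def sum.neutral_const)
    then show ?thesis
      using assms(4)[OF i] by (simp add: zero_set_def)
  qed
  \<comment> \<open>Krein-Milman in finite dimension: the compact convex hull is generated by its
    vertices.\<close>
  have hull: "convex hull zero_set K = convex hull Z"
    unfolding Z polytope_vertices_def
    by (intro Krein_Milman_Minkowski compact_convex_hull compact_zero_set convex_convex_hull)
  have Zzero: "Z \<subseteq> zero_set K"
    unfolding Z polytope_vertices_def using extreme_point_of_convex_hull by blast
  have Zfin: "finite Z"
    unfolding Z using finite_polytope_vertices_zero_set[OF cop] .
  have ZT: "Z \<subseteq> std_simplex"
    using Zzero by (auto simp: zero_set_def)
  have Zne: "Z \<noteq> {}"
    using hull t assms(3) by fastforce
  have tau_nonneg: "0 \<le> (D *v \<tau>) $ k" if "D \<in> K" "\<tau> \<in> Z" for D \<tau> k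
    using that cop ZT Zzero by (intro copositive_zero_nonneg std_simplexD) (auto simp: zero_set_def)
  have simplex_nonneg: "0 \<le> s \<bullet> (D *v s)" if "D \<in> K" "s \<in> std_simplex" for D s
    using that cop std_simplexD(1) by (fastforce simp: copositive_cone_def)
  have "K \<subseteq> Kbar"
  proof
    fix D
    assume D: "D \<in> K"
    then have "transpose D = D"
      using cop by (auto simp: copositive_cone_def)
    then show "D \<in> Kbar"
      using simplex_nonneg[OF D] tau_nonneg[OF D] D
      by (auto simp: Kbar outer_region_def null_rows_def row)
  qed
  moreover have "Kbar \<subseteq> K"
  proof
    fix D
    assume D: "D \<in> Kbar"
    have null: "(D *v \<tau>) $ k = 0" if "\<tau> \<in> Z" "k \<in> null_rows K \<tau>" for \<tau> k
      using D that by (auto simp: Kbar row)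
    have nonneg: "0 \<le> (D *v \<tau>) $ k" if "\<tau> \<in> Z" for \<tau> k
      using D that null[OF that, of k] by (cases "k \<in> null_rows K \<tau>") (auto simp: Kbar row)
    \<comment> \<open>The vertices are zeros of every matrix in \<open>K\<close>, so complementary
      slackness makes their support rows null rows. The equations in \<open>Kbar\<close> then make
      the form of \<open>D\<close> vanish at each vertex.\<close>
    have supp: "pos_supp \<tau> \<subseteq> null_rows K \<tau>" if "\<tau> \<in> Z" for \<tau>
    proof -
      have "(E *v \<tau>) $ k = 0" if "E \<in> K" "k \<in> pos_supp \<tau>" for E k
        using that \<open>\<tau> \<in> Z\<close> cop ZT Zzero
        by (intro copositive_zero_on_supp std_simplexD) (auto simp: zero_set_def)
      then show ?thesis
        by (auto simp: null_rows_def row)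
    qed
    have "\<tau> $ k * (D *v \<tau>) $ k = 0" if "\<tau> \<in> Z" for \<tau> k
      using null[OF that, of k] supp[OF that] std_simplexD(1)[of \<tau> k] ZT that
      by (cases "k \<in> pos_supp \<tau>") (auto simp: pos_supp_def)
    then have "\<tau> \<bullet> (D *v \<tau>) = 0" if "\<tau> \<in> Z" for \<tau>
      using that by (simp only: inner_vec_def inner_real_def sum.neutral_const)
    then have "D \<in> copositive_cone"
      using D nonneg
      by (intro copositive_if_nonneg_on_outer_region[OF Zfin Zne ZT]) (auto simp: Kbar)
    moreover have "(D *v t i) $ k = 0" if i: "i \<in> I" and k: "k \<in> L i" for i k
    proof -
      have "t i \<in> convex hull Z"
        using t[OF i] hull by (metis hull_inc)
      then obtain u where u: "\<And>w. w \<in> Z \<Longrightarrow> 0 \<le> u w" "sum u Z = 1" "t i = (\<Sum>w\<in>Z. u w *\<^sub>R w)"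
        using convex_hull_finite_expand[OF Zfin] by blast
      have expand: "(E *v t i) $ k = (\<Sum>w\<in>Z. u w * (E *v w) $ k)" for E :: "real ^ 'n ^ 'n"
        unfolding u(3) by (simp add: linear_sum[OF matrix_vector_mul_linear] matrix_vector_mult_scaleR)
      \<comment> \<open>For \<open>E\<close> in \<open>K\<close> the row \<open>k\<close> at
        \<open>t i\<close> is zero, and it is a combination of nonnegative rows at the vertices.
        Each vertex with nonzero weight thus has \<open>k\<close> as a null row, and this transfers
        the equation to \<open>D\<close>.\<close>
      have "k \<in> null_rows K w" if w: "w \<in> Z" "u w \<noteq> 0" for w
      proof -
        have "(E *v w) $ k = 0" if E: "E \<in> K" for E
        proof -
          have "(\<Sum>w\<in>Z. u w * (E *v w) $ k) = 0"
            using E i k K by (simp flip: expand add: row)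
          then have "u w * (E *v w) $ k = 0"
            using w(1) u(1) tau_nonneg[OF E] Zfin by (simp add: sum_nonneg_eq_0_iff)
          with w(2) show ?thesis
            by simp
        qed
        then show ?thesis
          by (simp add: null_rows_def row)
      qed
      then have "u w * (D *v w) $ k = 0" if "w \<in> Z" for w
        using null[OF that] that by (cases "u w = 0") auto
      then show ?thesis
        unfolding expand by (simp only: sum.neutral_const cong: sum.cong)
    qed
    ultimately show "D \<in> K"
      by (simp add: K row)
  qed
  ultimately have eq: "K = Kbar"
    by blast
  have lin: "linear (\<lambda>D :: real ^ 'n ^ 'n. x \<bullet> (D *v y))" for x y
    by (intro linearI)
      (simp_all add: matrix_vector_mult_add_rdistrib inner_add_right scaleR_matrix_vector_assoc[symmetric])
  have "convex K"
  proof (rule convexI)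
    fix A B and u v :: real
    assume AB: "A \<in> K" "B \<in> K" "0 \<le> u" "0 \<le> v"
    have comb: "x \<bullet> ((u *\<^sub>R A + v *\<^sub>R B) *v y) = u * (x \<bullet> (A *v y)) + v * (x \<bullet> (B *v y))" for x y
      by (simp only: linear_add[OF lin] linear_scale[OF lin] real_scaleR_def)
    have "transpose (u *\<^sub>R A + v *\<^sub>R B) = u *\<^sub>R transpose A + v *\<^sub>R transpose B"
      by (simp add: transpose_def vec_eq_iff)
    with AB show "u *\<^sub>R A + v *\<^sub>R B \<in> K"
      by (simp add: K copositive_cone_def comb)
  qed
  moreover have "0 \<in> K"
    by (simp add: K copositive_cone_def transpose_def vec_eq_iff)
  \<comment> \<open>A nonempty convex set in finite dimension has a nonempty relative interior. One
    point of it serves all strict inequalities at once, infinitely many or not.\<close>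
  ultimately obtain Dbar where Dbar: "Dbar \<in> rel_interior K"
    using rel_interior_eq_empty[of K] by blast
  have "0 < s \<bullet> (Dbar *v s)" if s: "s \<in> outer_region Z" for s
  proof -
    have sT: "s \<in> std_simplex"
      using s by (simp add: outer_region_def)
    \<comment> \<open>The common zeros lie in the hull of \<open>Z\<close>, which misses the outer
      region. So some \<open>E\<close> in \<open>K\<close> is nonzero, hence positive, at
      \<open>s\<close>, and the functional sending \<open>D\<close> to
      \<open>s \<bullet> (D *v s)\<close> is positive at \<open>Dbar\<close>.\<close>
    have "s \<notin> zero_set K"
      using convex_hull_disjoint_outer_region[OF Zfin Zne ZT] s hull by (metis hull_inc)
    then obtain E where "E \<in> K" "s \<bullet> (E *v s) \<noteq> 0"
      using sT by (auto simp: zero_set_def)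
    then show ?thesis
      using rel_interior_pos_functional[OF \<open>convex K\<close> Dbar lin simplex_nonneg[OF _ sT], of E]
        simplex_nonneg[OF _ sT, of E] by fastforce
  qed
  moreover have "0 < axis k 1 \<bullet> (Dbar *v \<tau>)" if \<tau>: "\<tau> \<in> Z" and k: "k \<notin> null_rows K \<tau>" for \<tau> k
  proof -
    obtain E where E: "E \<in> K" "axis k 1 \<bullet> (E *v \<tau>) \<noteq> 0"
      using k by (auto simp: null_rows_def)
    have nonneg: "0 \<le> axis k 1 \<bullet> (F *v \<tau>)" if "F \<in> K" for F
      using tau_nonneg[OF that \<tau>] by (simp add: row)
    show ?thesis
      using rel_interior_pos_functional[OF \<open>convex K\<close> Dbar lin nonneg E(1)] E nonneg[OF E(1)]
      by linarith
  qed
  moreover have "Dbar \<in> Kbar"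
    using Dbar rel_interior_subset eq by blast
  ultimately show ?thesis
    using eq by blast
qed

end
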